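(* Let $X$ be a Hilbert space, let $(t_i)_{i\geq1}$ be a sequence of distinct points of $T$ and let $\omega_i:T\to T$ be the constant function $\omega_i(t)=t_i$ for all $t\in T$, $i\in\mathbb{N}^{\ast}$. Let $(R_i)_{i\geq1}\subset\mathcal{L}(X)$, let $\mu^0\in cabv(X)$, and assume $$e=\sum_{i=1}^{\infty}\|R_i\|_o<1.$$ Put $R=\sum_{i=1}^{\infty}R_i\in\mathcal{L}(X)$. Define $H_2:cabv(X)\to cabv(X)$ via $$H_2(\mu)=H(\mu)+\mu^0=\sum_{i=1}^{\infty}\delta_{t_i}R_i(\mu(T))+\mu^0,$$ where $H(\mu)=\sum_{i=1}^{\infty}R_i\circ\omega_i(\mu)$. Then: (i) $Id_X-R$ is invertible in $\mathcal{L}(X)$. (ii) $H_2$ is a contraction with contraction factor $\leq e$ and possesses a unique $\mu^{\ast}\in cabv(X)$ with $H_2(\mu^{\ast})=\mu^{\ast}$. Moreover, $$\mu^{\ast}=\sum_{i=1}^{\infty}\delta_{t_i}\,(R_i\circ(Id_X-R)^{-1})(\mu^0(T))+\mu^0.$$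
   Context: All vector spaces are non-null and over $K=\mathbb{R}$ or $\mathbb{C}$; $\mathbb{N}^{\ast}=\{1,2,\dots\}$. $(T,d)$ is a compact metric space, $\mathcal{B}$ its Borel $\sigma$-algebra. A contraction is a Lipschitz self-map of a metric space with Lipschitz constant $<1$; this constant is its contraction factor. $\mathcal{L}(X)$ is the Banach algebra of continuous linear operators on $X$, with operator norm $\|\cdot\|_o$ and product given by composition. $cabv(X)$ is the Banach space of $\sigma$-additive $\mu:\mathcal{B}\to X$ with finite total variation, with the variational norm $\|\mu\|=|\mu|(T)=\sup\sum_i\|\mu(A_i)\|$ (supremum over finite Borel partitions $(A_i)$ of $T$); it is the norm used for the contraction statement, and the series of measures converge in $cabv(X)$ for it. For continuous $h:T\to T$, $h(\mu)(B)=\mu(h^{-1}(B))$ for $B\in\mathcal{B}$; for $R\in\mathcal{L}(X)$, $(R\circ h(\mu))(B)=R(\mu(h^{-1}(B)))$. $\delta_t$ is the Dirac measure concentrated at $t$, and for $x\in X$, $\delta_t x$ is the measure $B\mapsto\delta_t(B)x$. *)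

theory Defs
  imports "HOL-Analysis.Analysis"
begin

section \<open>Hilbert spaces over the real or the complex numbers\<close>

text \<open>
  The embedding makes the scalar type a copy of \<open>\<real>\<close> or of \<open>\<complex>\<close>, see
  \<open>range_to_complex\<close> below.
\<close>

class real_or_complex = real_normed_field +
  fixes to_complex :: "'a \<Rightarrow> complex"
  assumes to_complex_add: "to_complex (a + b) = to_complex a + to_complex b"
    and to_complex_mult: "to_complex (a * b) = to_complex a * to_complex b"
    and to_complex_1: "to_complex 1 = 1"
    and to_complex_scaleR: "to_complex (r *\<^sub>R a) = r *\<^sub>R to_complex a"
    and norm_to_complex: "norm (to_complex a) = norm a"

instantiation real :: real_or_complex
begin
definition to_complex_real :: "real \<Rightarrow> complex" where "to_complex_real = of_real"
instance by standard (auto simp: to_complex_real_def scaleR_conv_of_real)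
end

instantiation complex :: real_or_complex
begin
definition to_complex_complex :: "complex \<Rightarrow> complex" where "to_complex_complex = id"
instance by standard (auto simp: to_complex_complex_def)
end

lemma to_complex_of_real: "to_complex (of_real r) = of_real r"
  by (simp add: of_real_def to_complex_scaleR to_complex_1)

lemma range_to_complex:
  "range (to_complex :: 'a::real_or_complex \<Rightarrow> complex) = \<real>
   \<or> range (to_complex :: 'a \<Rightarrow> complex) = UNIV"
proof -
  let ?f = "to_complex :: 'a \<Rightarrow> complex"
  have real: "\<real> \<subseteq> range ?f"
  proof
    fix z :: complex assume "z \<in> \<real>"
    then obtain r where "z = of_real r" by (auto elim: Reals_cases)
    then have "z = ?f (of_real r)" by (simp add: to_complex_of_real)
    then show "z \<in> range ?f" by blast
  qed
  show ?thesis
  proof (cases "range ?f \<subseteq> \<real>")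
    case False
    then obtain a where a: "?f a \<notin> \<real>" by blast
    then have im: "Im (?f a) \<noteq> 0" by (simp add: complex_is_Real_iff)
    have "z \<in> range ?f" for z
    proof -
      define s where "s = Im z / Im (?f a)"
      define r where "r = Re z - s * Re (?f a)"
      have "?f (of_real r + of_real s * a) = of_real r + of_real s * ?f a"
        by (simp add: to_complex_add to_complex_mult to_complex_of_real)
      also have "\<dots> = z"
        using im by (simp add: complex_eq_iff r_def s_def)
      finally show ?thesis by (metis rangeI)
    qed
    then show ?thesis by blast
  qed (use real in blast)
qed

text \<open>
  The class \<open>banach\<close> supplies the norm, its completeness and the real part of the scalar
  multiplication; the inner product induces that norm and is linear in its first argument.
\<close>

locale hilbert_space = vector_space smul
  for smul :: "'k::real_or_complex \<Rightarrow> 'x::banach \<Rightarrow> 'x" +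
  fixes ip :: "'x \<Rightarrow> 'x \<Rightarrow> 'k"
  assumes smul_of_real: "smul (of_real r) x = r *\<^sub>R x"
    and ip_add_left: "ip (x + y) z = ip x z + ip y z"
    and ip_smul_left: "ip (smul a x) y = a * ip x y"
    and ip_commute: "to_complex (ip y x) = cnj (to_complex (ip x y))"
    and ip_self: "ip x x = of_real ((norm x)\<^sup>2)"

text \<open>For real scalars these are the Hilbert spaces of the library.\<close>

lemma hilbert_space_real:
  "hilbert_space (scaleR :: real \<Rightarrow> 'x::{real_inner,banach} \<Rightarrow> 'x) inner"
  by unfold_locales
    (auto simp: algebra_simps inner_add_left to_complex_real_def inner_commute power2_norm_eq_inner)

lemma hilbert_space_complex:
  "hilbert_space ((*) :: complex \<Rightarrow> complex \<Rightarrow> complex) (\<lambda>x y. x * cnj y)"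
  by unfold_locales
    (auto simp: algebra_simps to_complex_complex_def scaleR_conv_of_real complex_mult_cnj cmod_power2)

section \<open>The algebra of continuous linear operators\<close>

text \<open>
  The type \<^typ>\<open>'x \<Rightarrow>\<^sub>L 'x\<close> consists of the bounded real-linear operators, with the
  operator norm; linearity over the scalar field has to be added.
\<close>

definition cont_lin_ops ::
    "('k \<Rightarrow> 'x::real_normed_vector \<Rightarrow> 'x) \<Rightarrow> ('x \<Rightarrow>\<^sub>L 'x) set" where
  "cont_lin_ops smul =
     {A. \<forall>a x. blinfun_apply A (smul a x) = smul a (blinfun_apply A x)}"

definition is_inverse_in ::
    "('k \<Rightarrow> 'x::real_normed_vector \<Rightarrow> 'x) \<Rightarrow> ('x \<Rightarrow>\<^sub>L 'x) \<Rightarrow> ('x \<Rightarrow>\<^sub>L 'x) \<Rightarrow> bool" where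
  "is_inverse_in smul A B \<longleftrightarrow>
     B \<in> cont_lin_ops smul \<and> A o\<^sub>L B = id_blinfun \<and> B o\<^sub>L A = id_blinfun"

definition invertible_in ::
    "('k \<Rightarrow> 'x::real_normed_vector \<Rightarrow> 'x) \<Rightarrow> ('x \<Rightarrow>\<^sub>L 'x) \<Rightarrow> bool" where
  "invertible_in smul A \<longleftrightarrow> A \<in> cont_lin_ops smul \<and> (\<exists>B. is_inverse_in smul A B)"

definition inverse_in ::
    "('k \<Rightarrow> 'x::real_normed_vector \<Rightarrow> 'x) \<Rightarrow> ('x \<Rightarrow>\<^sub>L 'x) \<Rightarrow> ('x \<Rightarrow>\<^sub>L 'x)" where
  "inverse_in smul A = (THE B. is_inverse_in smul A B)"

lemma inverse_in_eqI:
  assumes "is_inverse_in smul A B"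
  shows "inverse_in smul A = B"
  unfolding inverse_in_def
proof (rule the_equality)
  fix C assume "is_inverse_in smul A C"
  then have C: "blinfun_apply C (blinfun_apply A x) = x" for x
    by (metis blinfun_apply_blinfun_compose id_blinfun.rep_eq id_apply is_inverse_in_def)
  have B: "blinfun_apply A (blinfun_apply B x) = x" for x
    using assms by (metis blinfun_apply_blinfun_compose id_blinfun.rep_eq id_apply is_inverse_in_def)
  show "C = B"
  proof (rule blinfun_eqI)
    show "blinfun_apply C x = blinfun_apply B x" for x
      using C[of "blinfun_apply B x"] by (simp add: B)
  qed
qed (fact assms)

section \<open>Vector measures of bounded variation\<close>

definition vector_measure :: "('t::topological_space set \<Rightarrow> 'x::real_normed_vector) \<Rightarrow> bool" where
  "vector_measure m \<longleftrightarrow>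
     (\<forall>A :: nat \<Rightarrow> 't set. range A \<subseteq> sets borel \<longrightarrow> disjoint_family A \<longrightarrow>
        (\<lambda>n. m (A n)) sums m (\<Union>n. A n))"

definition borel_partitions :: "'t::topological_space set set set" where
  "borel_partitions = {P. finite P \<and> P \<subseteq> sets borel \<and> partition_on UNIV P}"

definition variation_sums :: "('t::topological_space set \<Rightarrow> 'x::real_normed_vector) \<Rightarrow> real set" where
  "variation_sums m = (\<lambda>P. \<Sum>A\<in>P. norm (m A)) ` borel_partitions"

definition total_variation :: "('t::topological_space set \<Rightarrow> 'x::real_normed_vector) \<Rightarrow> real" where
  "total_variation m = Sup (variation_sums m)"

lemma vector_measure_empty:
  assumes "vector_measure m" shows "m {} = 0"
proof -
  have "(\<lambda>n::nat. m {}) sums m (\<Union>n::nat. {})"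
    using assms[unfolded vector_measure_def, rule_format, of "\<lambda>_. {}"]
    by (auto simp: disjoint_family_on_def)
  then show ?thesis
    by (auto dest!: sums_summable simp: summable_const_iff)
qed

lemma vector_measure_Un:
  assumes m: "vector_measure m" and A: "A \<in> sets borel" "B \<in> sets borel" "A \<inter> B = {}"
  shows "m (A \<union> B) = m A + m B"
proof -
  have "(\<lambda>n. m (binaryset A B n)) sums m (\<Union>n. binaryset A B n)"
    using A by (intro m[unfolded vector_measure_def, rule_format])
      (auto simp: range_binaryset_eq disjoint_family_on_def binaryset_def)
  moreover have "(\<lambda>n. m (binaryset A B n)) sums (m A + m B)"
    by (rule binaryset_sums) (rule vector_measure_empty[of m, OF m])
  ultimately show ?thesis
    by (metis UN_binaryset_eq sums_unique2)
qed

lemma UNIV_in_borel_partitions: "{UNIV} \<in> borel_partitions"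
  by (auto simp: borel_partitions_def partition_on_def)

lemma variation_sums_nonempty: "variation_sums m \<noteq> {}"
  using UNIV_in_borel_partitions by (auto simp: variation_sums_def)

lemma total_variation_upper:
  assumes "bdd_above (variation_sums m)" "P \<in> borel_partitions"
  shows "(\<Sum>A\<in>P. norm (m A)) \<le> total_variation m"
  unfolding total_variation_def
  using assms by (intro cSup_upper) (auto simp: variation_sums_def)

lemma total_variation_least:
  assumes "\<And>P. P \<in> borel_partitions \<Longrightarrow> (\<Sum>A\<in>P. norm (m A)) \<le> c"
  shows "total_variation m \<le> c"
  unfolding total_variation_def
  using assms by (intro cSup_least variation_sums_nonempty) (auto simp: variation_sums_def)

lemma bdd_variation_sumsI:
  assumes "\<And>P. P \<in> borel_partitions \<Longrightarrow> (\<Sum>A\<in>P. norm (m A)) \<le> c"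
  shows "bdd_above (variation_sums m)"
  using assms by (auto simp: variation_sums_def intro!: bdd_aboveI[of _ c])

text \<open>
  The measures live on the Borel sets only; extending them by zero to all sets makes equality of
  measures the equality of functions.
\<close>

typedef (overloaded) ('t, 'x) cabv =
  "{m :: 't::topological_space set \<Rightarrow> 'x::real_normed_vector.
      vector_measure m \<and> bdd_above (variation_sums m) \<and> (\<forall>B. B \<notin> sets borel \<longrightarrow> m B = 0)}"
  morphisms meas Abs_cabv
proof -
  have "(\<lambda>_::'t set. 0::'x) \<in> {m. vector_measure m \<and> bdd_above (variation_sums m) \<and>
      (\<forall>B. B \<notin> sets borel \<longrightarrow> m B = 0)}"
    by (auto simp: vector_measure_def intro!: bdd_variation_sumsI[of _ 0])
  then show ?thesis by blast
qed

setup_lifting type_definition_cabv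

lemma meas_vector_measure: "vector_measure (meas \<mu>)"
  and meas_bdd: "bdd_above (variation_sums (meas \<mu>))"
  and meas_outside: "B \<notin> sets borel \<Longrightarrow> meas \<mu> B = 0"
  using meas[of \<mu>] by auto

lemma cabv_eqI:
  assumes "\<And>B. B \<in> sets borel \<Longrightarrow> meas \<mu> B = meas \<nu> B"
  shows "\<mu> = \<nu>"
  by (metis assms ext meas_inject meas_outside)

lemma cabv_linear_aux:
  assumes f: "bounded_linear f" and m: "vector_measure m" "bdd_above (variation_sums m)"
  shows "vector_measure (\<lambda>B. f (m B))" "bdd_above (variation_sums (\<lambda>B. f (m B)))"
    "total_variation (\<lambda>B. f (m B)) \<le> onorm f * total_variation m"
proof -
  show "vector_measure (\<lambda>B. f (m B))"
    using m(1) unfolding vector_measure_def by (auto intro: bounded_linear.sums[OF f])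
  have *: "(\<Sum>A\<in>P. norm (f (m A))) \<le> onorm f * total_variation m" if "P \<in> borel_partitions" for P
  proof -
    have "(\<Sum>A\<in>P. norm (f (m A))) \<le> (\<Sum>A\<in>P. onorm f * norm (m A))"
      by (intro sum_mono onorm f)
    also have "\<dots> = onorm f * (\<Sum>A\<in>P. norm (m A))"
      by (simp add: sum_distrib_left)
    also have "\<dots> \<le> onorm f * total_variation m"
      by (intro mult_left_mono total_variation_upper m that onorm_pos_le f)
    finally show ?thesis .
  qed
  show "bdd_above (variation_sums (\<lambda>B. f (m B)))"
    by (rule bdd_variation_sumsI[OF *])
  show "total_variation (\<lambda>B. f (m B)) \<le> onorm f * total_variation m"
    by (rule total_variation_least[OF *])
qed

lemma cabv_add_aux:
  assumes m: "vector_measure m" "bdd_above (variation_sums m)"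
    and n: "vector_measure n" "bdd_above (variation_sums n)"
  shows "vector_measure (\<lambda>B. m B + n B)" "bdd_above (variation_sums (\<lambda>B. m B + n B))"
    "total_variation (\<lambda>B. m B + n B) \<le> total_variation m + total_variation n"
proof -
  show "vector_measure (\<lambda>B. m B + n B)"
    using m(1) n(1) unfolding vector_measure_def by (auto intro: sums_add)
  have *: "(\<Sum>A\<in>P. norm (m A + n A)) \<le> total_variation m + total_variation n"
    if "P \<in> borel_partitions" for P
  proof -
    have "(\<Sum>A\<in>P. norm (m A + n A)) \<le> (\<Sum>A\<in>P. norm (m A)) + (\<Sum>A\<in>P. norm (n A))"
      by (simp add: sum.distrib[symmetric] sum_mono norm_triangle_ineq)
    also have "\<dots> \<le> total_variation m + total_variation n"
      by (intro add_mono total_variation_upper m n that)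
    finally show ?thesis .
  qed
  show "bdd_above (variation_sums (\<lambda>B. m B + n B))"
    by (rule bdd_variation_sumsI[OF *])
  show "total_variation (\<lambda>B. m B + n B) \<le> total_variation m + total_variation n"
    by (rule total_variation_least[OF *])
qed

lemma norm_le_total_variation:
  assumes m: "vector_measure m" "bdd_above (variation_sums m)" and B: "B \<in> sets borel"
  shows "norm (m B) \<le> total_variation m"
proof (cases "B = {} \<or> B = UNIV")
  case True
  have "norm (m UNIV) \<le> total_variation m"
    using total_variation_upper[OF m(2) UNIV_in_borel_partitions] by simp
  moreover have "0 \<le> norm (m UNIV)" by simp
  ultimately show ?thesis
    using True vector_measure_empty[OF m(1)] by (metis norm_zero order_trans)
next
  case False
  then have "{B, - B} \<in> borel_partitions"
    using B by (auto simp: borel_partitions_def partition_on_def disjoint_def)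
  from total_variation_upper[OF m(2) this] have "norm (m B) + norm (m (- B)) \<le> total_variation m"
    using False by (subst (asm) sum.insert) auto
  then show ?thesis
    by (metis add.commute add_increasing norm_ge_zero order_trans order_refl)
qed

instantiation cabv :: (topological_space, real_normed_vector) real_normed_vector
begin

lift_definition zero_cabv :: "('a, 'b) cabv" is "\<lambda>_. 0"
  by (auto simp: vector_measure_def intro!: bdd_variation_sumsI[of _ 0])

lift_definition plus_cabv :: "('a, 'b) cabv \<Rightarrow> ('a, 'b) cabv \<Rightarrow> ('a, 'b) cabv"
  is "\<lambda>m n B. m B + n B"
  by (simp add: cabv_add_aux)

lift_definition uminus_cabv :: "('a, 'b) cabv \<Rightarrow> ('a, 'b) cabv" is "\<lambda>m B. - m B"
  by (simp add: cabv_linear_aux[OF bounded_linear_minus[OF bounded_linear_ident]])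

lift_definition minus_cabv :: "('a, 'b) cabv \<Rightarrow> ('a, 'b) cabv \<Rightarrow> ('a, 'b) cabv"
  is "\<lambda>m n B. m B - n B"
proof -
  fix m n :: "'a set \<Rightarrow> 'b"
  assume m: "vector_measure m \<and> bdd_above (variation_sums m) \<and> (\<forall>B. B \<notin> sets borel \<longrightarrow> m B = 0)"
    and n: "vector_measure n \<and> bdd_above (variation_sums n) \<and> (\<forall>B. B \<notin> sets borel \<longrightarrow> n B = 0)"
  have "vector_measure (\<lambda>B. - n B)" "bdd_above (variation_sums (\<lambda>B. - n B))"
    using n by (simp_all add: cabv_linear_aux[OF bounded_linear_minus[OF bounded_linear_ident]])
  from cabv_add_aux[OF _ _ this, of m] m n
  show "vector_measure (\<lambda>B. m B - n B) \<and> bdd_above (variation_sums (\<lambda>B. m B - n B)) \<and>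
      (\<forall>B. B \<notin> sets borel \<longrightarrow> m B - n B = 0)"
    by simp
qed

lift_definition scaleR_cabv :: "real \<Rightarrow> ('a, 'b) cabv \<Rightarrow> ('a, 'b) cabv" is "\<lambda>r m B. r *\<^sub>R m B"
  by (simp add: cabv_linear_aux[OF bounded_linear_scaleR_right])

lift_definition norm_cabv :: "('a, 'b) cabv \<Rightarrow> real" is total_variation .

definition dist_cabv :: "('a, 'b) cabv \<Rightarrow> ('a, 'b) cabv \<Rightarrow> real" where
  "dist_cabv \<mu> \<nu> = norm (\<mu> - \<nu>)"

definition sgn_cabv :: "('a, 'b) cabv \<Rightarrow> ('a, 'b) cabv" where
  "sgn_cabv \<mu> = inverse (norm \<mu>) *\<^sub>R \<mu>"

definition uniformity_cabv :: "(('a, 'b) cabv \<times> ('a, 'b) cabv) filter" where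
  "uniformity_cabv = (INF e\<in>{0 <..}. principal {(\<mu>, \<nu>). dist \<mu> \<nu> < e})"

definition open_cabv :: "('a, 'b) cabv set \<Rightarrow> bool" where
  "open_cabv S = (\<forall>\<mu>\<in>S. \<forall>\<^sub>F (\<mu>', \<nu>) in uniformity. \<mu>' = \<mu> \<longrightarrow> \<nu> \<in> S)"

instance
proof
  fix \<mu> \<nu> \<rho> :: "('a, 'b) cabv" and r s :: real
  show "\<mu> + \<nu> + \<rho> = \<mu> + (\<nu> + \<rho>)" by transfer (simp add: add.assoc)
  show "\<mu> + \<nu> = \<nu> + \<mu>" by transfer (simp add: add.commute)
  show "0 + \<mu> = \<mu>" by transfer simp
  show "- \<mu> + \<mu> = 0" by transfer simp
  show "\<mu> - \<nu> = \<mu> + - \<nu>" by transfer simp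
  show "r *\<^sub>R (\<mu> + \<nu>) = r *\<^sub>R \<mu> + r *\<^sub>R \<nu>" by transfer (simp add: scaleR_add_right)
  show "(r + s) *\<^sub>R \<mu> = r *\<^sub>R \<mu> + s *\<^sub>R \<mu>" by transfer (simp add: scaleR_add_left)
  show "r *\<^sub>R s *\<^sub>R \<mu> = (r * s) *\<^sub>R \<mu>" by transfer simp
  show "1 *\<^sub>R \<mu> = \<mu>" by transfer simp
  show "dist \<mu> \<nu> = norm (\<mu> - \<nu>)" by (rule dist_cabv_def)
  show "sgn \<mu> = inverse (norm \<mu>) *\<^sub>R \<mu>" by (rule sgn_cabv_def)
  show "uniformity = (INF e\<in>{0 <..}. principal {(\<mu> :: ('a, 'b) cabv, \<nu>). dist \<mu> \<nu> < e})"
    by (rule uniformity_cabv_def)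
  show "open S = (\<forall>\<mu>\<in>S. \<forall>\<^sub>F (\<mu>', \<nu>) in uniformity. \<mu>' = \<mu> \<longrightarrow> \<nu> \<in> S)" for S :: "('a, 'b) cabv set"
    by (rule open_cabv_def)
  have nonneg: "0 \<le> norm \<mu>" for \<mu> :: "('a, 'b) cabv"
  proof -
    have "norm (meas \<mu> UNIV) \<le> total_variation (meas \<mu>)"
      by (intro norm_le_total_variation meas_vector_measure meas_bdd) simp
    then show ?thesis
      unfolding norm_cabv.rep_eq using norm_ge_zero by (rule order_trans[rotated])
  qed
  show "norm \<mu> = 0 \<longleftrightarrow> \<mu> = 0"
  proof
    assume *: "norm \<mu> = 0"
    show "\<mu> = 0"
    proof (rule cabv_eqI)
      fix B :: "'a set" assume "B \<in> sets borel"
      then have "norm (meas \<mu> B) \<le> total_variation (meas \<mu>)"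
        by (intro norm_le_total_variation meas_vector_measure meas_bdd)
      then show "meas \<mu> B = meas 0 B"
        using * by (simp add: norm_cabv.rep_eq zero_cabv.rep_eq)
    qed
  next
    assume "\<mu> = 0"
    then have "norm \<mu> \<le> 0"
      by (auto simp: norm_cabv.rep_eq zero_cabv.rep_eq intro!: total_variation_least)
    with nonneg[of \<mu>] show "norm \<mu> = 0" by simp
  qed
  show "norm (\<mu> + \<nu>) \<le> norm \<mu> + norm \<nu>"
    by transfer (simp add: cabv_add_aux)
  have le: "norm (r *\<^sub>R \<mu>) \<le> \<bar>r\<bar> * norm \<mu>" for r and \<mu> :: "('a, 'b) cabv"
  proof -
    have "onorm (\<lambda>x :: 'b. r *\<^sub>R x) \<le> \<bar>r\<bar>"
      by (rule onorm_bound) simp_all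
    then have "onorm (\<lambda>x :: 'b. r *\<^sub>R x) * norm \<mu> \<le> \<bar>r\<bar> * norm \<mu>"
      using nonneg by (rule mult_right_mono)
    moreover have "norm (r *\<^sub>R \<mu>) \<le> onorm (\<lambda>x :: 'b. r *\<^sub>R x) * norm \<mu>"
      unfolding norm_cabv.rep_eq scaleR_cabv.rep_eq
      by (rule cabv_linear_aux(3)[OF bounded_linear_scaleR_right meas_vector_measure meas_bdd])
    ultimately show ?thesis by linarith
  qed
  show "norm (r *\<^sub>R \<mu>) = \<bar>r\<bar> * norm \<mu>"
  proof (cases "r = 0")
    case True
    then show ?thesis using le[of r \<mu>] nonneg[of "r *\<^sub>R \<mu>"] by simp
  next
    case False
    have "(1 / r) *\<^sub>R r *\<^sub>R \<mu> = \<mu>" using False by transfer simp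
    with le[of "1 / r" "r *\<^sub>R \<mu>"] have "norm \<mu> \<le> norm (r *\<^sub>R \<mu>) / \<bar>r\<bar>" by simp
    then have "\<bar>r\<bar> * norm \<mu> \<le> norm (r *\<^sub>R \<mu>)" using False by (simp add: field_simps)
    with le[of r \<mu>] show ?thesis by simp
  qed
qed

end

lemma norm_meas_le: "norm (meas \<mu> B) \<le> norm \<mu>"
proof (cases "B \<in> sets borel")
  case True
  then show ?thesis
    unfolding norm_cabv.rep_eq by (intro norm_le_total_variation meas_vector_measure meas_bdd)
qed (simp add: meas_outside)

instance cabv :: (topological_space, banach) banach
proof
  fix X :: "nat \<Rightarrow> ('a, 'b) cabv"
  assume X: "Cauchy X"
  have CX: "\<exists>N. \<forall>i\<ge>N. \<forall>j\<ge>N. norm (X i - X j) < c" if "c > 0" for c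
    using X that by (simp add: Cauchy_def dist_norm)
  have "Cauchy (\<lambda>i. meas (X i) B)" for B
  proof (rule CauchyI)
    fix c :: real assume "c > 0"
    with CX obtain N where N: "\<forall>i\<ge>N. \<forall>j\<ge>N. norm (X i - X j) < c" by blast
    have "norm (meas (X i) B - meas (X j) B) < c" if "i \<ge> N" "j \<ge> N" for i j
      using N that norm_meas_le[of "X i - X j" B] by (fastforce simp: minus_cabv.rep_eq)
    then show "\<exists>N. \<forall>i\<ge>N. \<forall>j\<ge>N. norm (meas (X i) B - meas (X j) B) < c" by blast
  qed
  then have "\<exists>l. (\<lambda>i. meas (X i) B) \<longlonglongrightarrow> l" for B
    by (simp add: Cauchy_convergent convergentD)
  then obtain m where m: "\<And>B. (\<lambda>i. meas (X i) B) \<longlonglongrightarrow> m B" by metis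
  have var: "(\<Sum>A\<in>P. norm (m A - meas (X i) A)) \<le> c"
    if N: "\<forall>i\<ge>N. \<forall>j\<ge>N. norm (X i - X j) < c" and "i \<ge> N" and P: "P \<in> borel_partitions" for i N c P
  proof (rule tendsto_upperbound)
    show "(\<lambda>j. \<Sum>A\<in>P. norm (meas (X j) A - meas (X i) A))
        \<longlonglongrightarrow> (\<Sum>A\<in>P. norm (m A - meas (X i) A))"
      by (intro tendsto_sum tendsto_norm tendsto_diff m tendsto_const)
    show "\<forall>\<^sub>F j in sequentially. (\<Sum>A\<in>P. norm (meas (X j) A - meas (X i) A)) \<le> c"
    proof (rule eventually_sequentiallyI)
      fix j assume "j \<ge> N"
      have "(\<Sum>A\<in>P. norm (meas (X j - X i) A)) \<le> norm (X j - X i)"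
        unfolding norm_cabv.rep_eq by (rule total_variation_upper[OF meas_bdd P])
      with N \<open>j \<ge> N\<close> \<open>i \<ge> N\<close> show "(\<Sum>A\<in>P. norm (meas (X j) A - meas (X i) A)) \<le> c"
        by (fastforce simp: minus_cabv.rep_eq)
    qed
  qed simp
  have tail: "norm (m B - meas (X i) B) \<le> c"
    if N: "\<forall>i\<ge>N. \<forall>j\<ge>N. norm (X i - X j) < c" and "i \<ge> N" for i N c B
  proof (rule tendsto_upperbound)
    show "(\<lambda>j. norm (meas (X j) B - meas (X i) B)) \<longlonglongrightarrow> norm (m B - meas (X i) B)"
      by (intro tendsto_norm tendsto_diff m tendsto_const)
    show "\<forall>\<^sub>F j in sequentially. norm (meas (X j) B - meas (X i) B) \<le> c"
    proof (rule eventually_sequentiallyI)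
      fix j assume "j \<ge> N"
      with N \<open>i \<ge> N\<close> norm_meas_le[of "X j - X i" B]
      show "norm (meas (X j) B - meas (X i) B) \<le> c"
        by (fastforce simp: minus_cabv.rep_eq)
    qed
  qed simp
  have outside: "m B = 0" if "B \<notin> sets borel" for B
    using m[of B] that by (simp add: meas_outside LIMSEQ_const_iff)
  have Un: "m (A \<union> B) = m A + m B" if "A \<in> sets borel" "B \<in> sets borel" "A \<inter> B = {}" for A B
  proof -
    have "(\<lambda>i. meas (X i) (A \<union> B)) \<longlonglongrightarrow> m A + m B"
      using that by (simp add: vector_measure_Un meas_vector_measure tendsto_add m)
    with m[of "A \<union> B"] show ?thesis by (rule LIMSEQ_unique)
  qed
  have empty: "m {} = 0"
    using Un[of "{}" "{}"] by simp
  have vm: "vector_measure m"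
    unfolding vector_measure_def
  proof (intro allI impI)
    fix A :: "nat \<Rightarrow> 'a set" assume A: "range A \<subseteq> sets borel" "disjoint_family A"
    then have Ab: "A n \<in> sets borel" for n by auto
    have split: "f (\<Union>n. A n) = (\<Sum>k<n. f (A k)) + f (\<Union>k\<in>{n..}. A k)"
      if f: "\<And>A B. A \<in> sets borel \<Longrightarrow> B \<in> sets borel \<Longrightarrow> A \<inter> B = {} \<Longrightarrow> f (A \<union> B) = f A + f B"
      for f :: "'a set \<Rightarrow> 'b" and n
    proof (induction n)
      case 0
      then show ?case by (simp add: atLeast_0)
    next
      case (Suc n)
      have "{n..} = insert n {Suc n..}" by auto
      then have eq: "(\<Union>k\<in>{n..}. A k) = A n \<union> (\<Union>k\<in>{Suc n..}. A k)"
        by (simp only: UN_insert)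
      have "A n \<inter> (\<Union>k\<in>{Suc n..}. A k) = {}"
        using A(2) unfolding disjoint_family_on_def
        by (simp add: Int_UN_distrib)
      then have "f (\<Union>k\<in>{n..}. A k) = f (A n) + f (\<Union>k\<in>{Suc n..}. A k)"
        unfolding eq by (intro f) (auto intro: Ab)
      with Suc show ?case by (simp add: add.assoc)
    qed
    have "(\<lambda>n. m (\<Union>k\<in>{n..}. A k)) \<longlonglongrightarrow> 0"
    proof (rule LIMSEQ_I)
      fix r :: real assume "r > 0"
      then obtain N where N: "\<forall>i\<ge>N. \<forall>j\<ge>N. norm (X i - X j) < r / 2" using CX[of "r / 2"] by auto
      have "(\<lambda>n. meas (X N) (A n)) sums meas (X N) (\<Union>n. A n)"
        using meas_vector_measure[of "X N"] A unfolding vector_measure_def by blast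
      then obtain M where M: "\<And>n. n \<ge> M \<Longrightarrow>
          norm ((\<Sum>k<n. meas (X N) (A k)) - meas (X N) (\<Union>n. A n)) < r / 2"
        using \<open>r > 0\<close> unfolding sums_def by (meson LIMSEQ_D half_gt_zero)
      have "norm (m (\<Union>k\<in>{n..}. A k) - 0) < r" if "n \<ge> M" for n
      proof -
        let ?T = "\<Union>k\<in>{n..}. A k"
        have "norm (meas (X N) ?T) < r / 2"
          using M[OF that] split[of "meas (X N)" n]
          by (simp add: vector_measure_Un meas_vector_measure)
        moreover have "norm (m ?T - meas (X N) ?T) \<le> r / 2"
          using tail[OF N] by simp
        ultimately show ?thesis
          using norm_triangle_ineq[of "m ?T - meas (X N) ?T" "meas (X N) ?T"] by simp
      qed
      then show "\<exists>M. \<forall>n\<ge>M. norm (m (\<Union>k\<in>{n..}. A k) - 0) < r" by blast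
    qed
    then have "(\<lambda>n. m (\<Union>n. A n) - m (\<Union>k\<in>{n..}. A k)) \<longlonglongrightarrow> m (\<Union>n. A n) - 0"
      by (intro tendsto_diff tendsto_const)
    moreover have "m (\<Union>n. A n) - m (\<Union>k\<in>{n..}. A k) = (\<Sum>k<n. m (A k))" for n
      using split[of m n, OF Un] by (simp only: add_diff_cancel_right')
    ultimately show "(\<lambda>n. m (A n)) sums m (\<Union>n. A n)"
      unfolding sums_def by simp
  qed
  have bdd: "bdd_above (variation_sums m)"
  proof -
    obtain N where N: "\<forall>i\<ge>N. \<forall>j\<ge>N. norm (X i - X j) < 1" using CX[of 1] by auto
    show ?thesis
    proof (rule bdd_variation_sumsI)
      fix P :: "'a set set" assume P: "P \<in> borel_partitions"
      have "(\<Sum>A\<in>P. norm (m A)) \<le> (\<Sum>A\<in>P. norm (m A - meas (X N) A) + norm (meas (X N) A))"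
        by (intro sum_mono) (metis diff_add_cancel norm_triangle_ineq)
      also have "\<dots> = (\<Sum>A\<in>P. norm (m A - meas (X N) A)) + (\<Sum>A\<in>P. norm (meas (X N) A))"
        by (rule sum.distrib)
      also have "\<dots> \<le> 1 + norm (X N)"
        unfolding norm_cabv.rep_eq by (intro add_mono var[OF N] total_variation_upper meas_bdd P) simp
      finally show "(\<Sum>A\<in>P. norm (m A)) \<le> 1 + norm (X N)" .
    qed
  qed
  define \<mu> where "\<mu> = Abs_cabv m"
  have \<mu>: "meas \<mu> = m"
    unfolding \<mu>_def using vm bdd outside by (simp add: Abs_cabv_inverse)
  have "X \<longlonglongrightarrow> \<mu>"
  proof (rule LIMSEQ_I)
    fix r :: real assume "r > 0"
    then obtain N where N: "\<forall>i\<ge>N. \<forall>j\<ge>N. norm (X i - X j) < r / 2" using CX[of "r / 2"] by auto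
    have "norm (X i - \<mu>) < r" if "i \<ge> N" for i
    proof -
      have "norm (\<mu> - X i) \<le> r / 2"
        unfolding norm_cabv.rep_eq
        by (rule total_variation_least) (simp only: minus_cabv.rep_eq \<mu> var[OF N that])
      with \<open>r > 0\<close> show ?thesis by (simp add: norm_minus_commute)
    qed
    then show "\<exists>N. \<forall>i\<ge>N. norm (X i - \<mu>) < r" by blast
  qed
  then show "convergent X" by (rule convergentI)
qed

section \<open>Operations on vector measures\<close>

text \<open>The image measure is only used for continuous maps; it is set to zero for the others.\<close>

lift_definition image_measure ::
    "('t::topological_space \<Rightarrow> 's::topological_space) \<Rightarrow> ('t, 'x::real_normed_vector) cabv \<Rightarrow> ('s, 'x) cabv"
  is "\<lambda>h m B. if continuous_on UNIV h \<and> B \<in> sets borel then m (h -` B) else 0"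
proof -
  fix h :: "'t \<Rightarrow> 's" and m :: "'t set \<Rightarrow> 'x"
  assume m: "vector_measure m \<and> bdd_above (variation_sums m) \<and> (\<forall>B. B \<notin> sets borel \<longrightarrow> m B = 0)"
  let ?n = "\<lambda>B. if continuous_on UNIV h \<and> B \<in> sets borel then m (h -` B) else 0"
  show "vector_measure ?n \<and> bdd_above (variation_sums ?n) \<and> (\<forall>B. B \<notin> sets borel \<longrightarrow> ?n B = 0)"
  proof (cases "continuous_on UNIV h")
    case False
    then show ?thesis by (auto simp: vector_measure_def intro!: bdd_variation_sumsI[of _ 0])
  next
    case True
    then have h: "h -` B \<in> sets borel" if "B \<in> sets borel" for B
      using measurable_sets[OF borel_measurable_continuous_onI that] by simp
    have vm: "vector_measure ?n"
      unfolding vector_measure_def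
    proof (intro allI impI)
      fix A :: "nat \<Rightarrow> 's set" assume A: "range A \<subseteq> sets borel" "disjoint_family A"
      then have Ab: "A i \<in> sets borel" for i by auto
      have "(\<lambda>i. m (h -` A i)) sums m (\<Union>i. h -` A i)"
        using m[THEN conjunct1, unfolded vector_measure_def, rule_format, of "\<lambda>i. h -` A i"] A(2) h[OF Ab]
        by (auto simp: disjoint_family_on_def)
      then show "(\<lambda>i. ?n (A i)) sums ?n (\<Union>i. A i)"
        using True Ab by (simp add: vimage_UN)
    qed
    have "(\<Sum>B\<in>P. norm (?n B)) \<le> total_variation m" if P: "P \<in> borel_partitions" for P
    proof -
      define Q where "Q = {B \<in> P. h -` B \<noteq> {}}"
      have fin: "finite P" and Pb: "\<And>B. B \<in> P \<Longrightarrow> B \<in> sets borel"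
        using P by (auto simp: borel_partitions_def)
      have disj: "\<And>A B. A \<in> P \<Longrightarrow> B \<in> P \<Longrightarrow> A \<noteq> B \<Longrightarrow> A \<inter> B = {}" and cov: "\<Union>P = UNIV"
        using P by (simp_all add: borel_partitions_def partition_on_def disjoint_def)
      have inj: "inj_on (\<lambda>B. h -` B) Q"
      proof (rule inj_onI, rule ccontr)
        fix A B assume AB: "A \<in> Q" "B \<in> Q" "h -` A = h -` B" "A \<noteq> B"
        then have "A \<in> P" "B \<in> P" "h -` A \<noteq> {}" by (simp_all add: Q_def)
        then obtain x where "h x \<in> A" by blast
        with AB(3) have "h x \<in> A \<inter> B" by blast
        with disj[OF \<open>A \<in> P\<close> \<open>B \<in> P\<close> \<open>A \<noteq> B\<close>] show False by simp
      qed
      have part: "(\<lambda>B. h -` B) ` Q \<in> borel_partitions"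
        unfolding borel_partitions_def partition_on_def mem_Collect_eq
      proof (intro conjI)
        show "finite ((\<lambda>B. h -` B) ` Q)" using fin by (simp add: Q_def)
        show "(\<lambda>B. h -` B) ` Q \<subseteq> sets borel"
          by (rule image_subsetI, rule h, rule Pb) (simp add: Q_def)
        have "x \<in> \<Union> ((\<lambda>B. h -` B) ` Q)" for x
        proof -
          have "h x \<in> \<Union>P" unfolding cov by (rule UNIV_I)
          then obtain B where "B \<in> P" "h x \<in> B" by (rule UnionE)
          then show ?thesis unfolding Q_def by blast
        qed
        then show "\<Union> ((\<lambda>B. h -` B) ` Q) = UNIV" by blast
        show "disjoint ((\<lambda>B. h -` B) ` Q)"
        proof (rule disjointI)
          fix a b assume ab: "a \<in> (\<lambda>B. h -` B) ` Q" "b \<in> (\<lambda>B. h -` B) ` Q" "a \<noteq> b"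
          then obtain A B where AB: "A \<in> P" "B \<in> P" "a = h -` A" "b = h -` B"
            unfolding Q_def by blast
          with ab(3) disj[of A B] have "A \<inter> B = {}" by blast
          with AB show "a \<inter> b = {}" by blast
        qed
        show "{} \<notin> (\<lambda>B. h -` B) ` Q" unfolding Q_def by blast
      qed
      have "(\<Sum>B\<in>P. norm (?n B)) = (\<Sum>B\<in>P. norm (m (h -` B)))"
        using Pb True by (intro sum.cong) auto
      also have "\<dots> = (\<Sum>B\<in>Q. norm (m (h -` B)))"
        using fin m by (intro sum.mono_neutral_right) (auto simp: Q_def vector_measure_empty)
      also have "\<dots> = (\<Sum>C\<in>(\<lambda>B. h -` B) ` Q. norm (m C))"
        by (simp add: sum.reindex[OF inj])
      also have "\<dots> \<le> total_variation m"
        using m by (intro total_variation_upper part) auto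
      finally show ?thesis .
    qed
    from bdd_variation_sumsI[OF this] vm show ?thesis by simp
  qed
qed

lift_definition op_measure ::
    "('x::real_normed_vector \<Rightarrow>\<^sub>L 'y::real_normed_vector) \<Rightarrow> ('t::topological_space, 'x) cabv \<Rightarrow> ('t, 'y) cabv"
  is "\<lambda>A m B. blinfun_apply A (m B)"
  by (simp add: blinfun.zero_right cabv_linear_aux[OF blinfun.bounded_linear_right])

lift_definition dirac_measure :: "'t::topological_space \<Rightarrow> 'x::real_normed_vector \<Rightarrow> ('t, 'x) cabv"
  is "\<lambda>t x B. if B \<in> sets borel then indicat_real B t *\<^sub>R x else 0"
proof -
  fix t :: 't and x :: 'x
  let ?n = "\<lambda>B. if B \<in> sets borel then indicat_real B t *\<^sub>R x else 0"
  have vm: "vector_measure ?n"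
    unfolding vector_measure_def
  proof (intro allI impI)
    fix A :: "nat \<Rightarrow> 't set" assume A: "range A \<subseteq> sets borel" "disjoint_family A"
    then have Ab: "A i \<in> sets borel" for i by auto
    have "(\<lambda>i. indicat_real (A i) t) sums indicat_real (\<Union>i. A i) t"
      using A(2) by (intro indicator_sums) (auto simp: disjoint_family_on_def)
    from sums_scaleR_left[OF this, of x] show "(\<lambda>i. ?n (A i)) sums ?n (\<Union>i. A i)"
      using Ab by simp
  qed
  show "vector_measure ?n \<and> bdd_above (variation_sums ?n) \<and> (\<forall>B. B \<notin> sets borel \<longrightarrow> ?n B = 0)"
  proof -
    have "(\<Sum>B\<in>P. norm (?n B)) \<le> norm x" if P: "P \<in> borel_partitions" for P
    proof -
      have fin: "finite P" and disj: "\<And>A B. A \<in> P \<Longrightarrow> B \<in> P \<Longrightarrow> A \<noteq> B \<Longrightarrow> A \<inter> B = {}"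
        and cov: "\<Union>P = UNIV"
        using P by (simp_all add: borel_partitions_def partition_on_def disjoint_def)
      have "t \<in> \<Union>P" unfolding cov by (rule UNIV_I)
      then obtain C where C: "C \<in> P" "t \<in> C" by (rule UnionE)
      have "t \<notin> B" if "B \<in> P - {C}" for B
        using that C disj[of B C] by blast
      then have "(\<Sum>B\<in>P. norm (?n B)) = (\<Sum>B\<in>{C}. norm (?n B))"
        using C fin by (intro sum.mono_neutral_right) simp_all
      also have "\<dots> \<le> norm x" by (simp add: indicator_def)
      finally show ?thesis .
    qed
    from bdd_variation_sumsI[OF this] vm show ?thesis by simp
  qed
qed

section \<open>Contractions\<close>

definition lipschitz_const :: "('a::metric_space \<Rightarrow> 'b::metric_space) \<Rightarrow> real" where
  "lipschitz_const f = Inf {L. L-lipschitz_on UNIV f}"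

definition contraction :: "('a::metric_space \<Rightarrow> 'a) \<Rightarrow> bool" where
  "contraction f \<longleftrightarrow> (\<exists>L. L-lipschitz_on UNIV f) \<and> lipschitz_const f < 1"

end

theory Submission
  imports Defs
begin

text \<open>
  Since \<open>\<omega>\<^sub>i\<close> is constant, the image measure \<open>\<omega>\<^sub>i(\<mu>)\<close> remembers only the total mass of \<open>\<mu>\<close>: it is
  \<open>\<delta>\<^bsub>t\<^sub>i\<^esub> \<mu>(T)\<close>. Hence \<open>H\<^sub>2 \<mu> = D (\<mu>(T)) + \<mu>\<^sup>0\<close>, where \<open>D v = \<Sum>\<^sub>i \<delta>\<^bsub>t\<^sub>i\<^esub> R\<^sub>i v\<close> is a linear map from
  \<open>X\<close> to \<open>cabv(X)\<close> with \<open>\<parallel>D v\<parallel> \<le> e \<parallel>v\<parallel>\<close>, because a Dirac measure \<open>\<delta>\<^sub>t x\<close> has total variation at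
  most \<open>\<parallel>x\<parallel>\<close> (lemma \<open>norm_dirac_series_le\<close>). As \<open>\<parallel>\<mu>(T)\<parallel> \<le> \<parallel>\<mu>\<parallel>\<close>, this gives the contraction.

  The total mass of \<open>D v\<close> is \<open>R v\<close> (lemma \<open>total_mass_dirac_series\<close>). The fixed point equation
  therefore reduces to an equation in \<open>X\<close> for the mass \<open>v = \<mu>(T)\<close>, namely \<open>v = R v + \<mu>\<^sup>0(T)\<close>, with
  the only solution \<open>v = (Id - R)\<^sup>-\<^sup>1 \<mu>\<^sup>0(T)\<close>; and \<open>v\<close> determines \<open>\<mu> = D v + \<mu>\<^sup>0\<close>. This yields
  existence, uniqueness and the formula together.

  Invertibility of \<open>Id - R\<close> follows from \<open>\<parallel>R\<parallel> \<le> e < 1\<close>. Instead of summing the Neumann series,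
  its sum \<open>B\<close> is obtained as the fixed point of the contraction \<open>B \<mapsto> Id + R \<circ> B\<close> of the Banach space
  of operators (lemma \<open>is_inverse_in_id_minus\<close>). Linearity over the scalar field passes from the
  \<open>R\<^sub>i\<close> to \<open>R\<close> because multiplication by a scalar is continuous, and from \<open>R\<close> to \<open>B\<close> because
  \<open>Id - R\<close> is injective.
\<close>

section \<open>Continuous linear operators over the scalar field\<close>

text \<open>
  Both sides of \<open>\<langle>a x, a x\<rangle> = a \<langle>x, a x\<rangle>\<close> are compared in absolute value; conjugate symmetry, used
  inside \<open>\<complex>\<close> through the isometric embedding, moves the second factor \<open>a\<close> to the left slot.
\<close>

lemma (in hilbert_space) norm_smul: "norm (smul a x) = norm a * norm x"
proof -
  have comm: "norm (ip y z) = norm (ip z y)" for y z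
    by (metis complex_mod_cnj ip_commute norm_to_complex)
  have "(norm (smul a x))\<^sup>2 = norm (ip (smul a x) (smul a x))"
    by (simp only: ip_self norm_of_real) simp
  also have "\<dots> = norm a * norm (ip x (smul a x))"
    by (simp add: ip_smul_left norm_mult)
  also have "norm (ip x (smul a x)) = norm a * norm (ip x x)"
    by (simp add: comm[of x "smul a x"] ip_smul_left norm_mult)
  also have "norm (ip x x) = (norm x)\<^sup>2"
    by (simp only: ip_self norm_of_real) simp
  finally have "(norm (smul a x))\<^sup>2 = (norm a * norm x)\<^sup>2"
    by (simp add: power2_eq_square)
  then show ?thesis by simp
qed

lemma (in hilbert_space) bounded_linear_smul: "bounded_linear (smul a)"
proof (rule bounded_linear_intro)
  show "smul a (r *\<^sub>R x) = r *\<^sub>R smul a x" for r x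
    by (simp add: mult.commute flip: smul_of_real)
  show "norm (smul a x) \<le> norm x * norm a" for x
    by (simp add: norm_smul)
qed (rule scale_right_distrib)

lemma (in hilbert_space) cont_lin_ops_sums:
  assumes "A sums S" and "\<And>i. A i \<in> cont_lin_ops smul"
  shows "S \<in> cont_lin_ops smul"
proof -
  have "S (smul a x) = smul a (S x)" for a x
  proof -
    have apply_sums: "(\<lambda>i. A i y) sums S y" for y
      by (rule bounded_linear.sums[OF bounded_linear_apply_blinfun assms(1)])
    have "(\<lambda>i. A i (smul a x)) sums smul a (S x)"
      using bounded_linear.sums[OF bounded_linear_smul apply_sums] assms(2)
      by (simp add: cont_lin_ops_def)
    with apply_sums show ?thesis by (rule sums_unique2)
  qed
  then show ?thesis by (simp add: cont_lin_ops_def)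
qed

lemma blinfun_fixed_point_zero:
  assumes "norm A < 1" and "blinfun_apply A x = x"
  shows "x = 0"
proof (rule ccontr)
  assume "x \<noteq> 0"
  then have "norm A * norm x < norm x" using assms(1) by simp
  with norm_blinfun[of A x] assms(2) show False by simp
qed

text \<open>
  A right inverse \<open>B\<close> of \<open>Id - A\<close> solves \<open>B = Id + A \<circ> B\<close>, a fixed point equation for a contraction
  of the space of operators. Since \<open>A\<close> has no nonzero fixed vector, \<open>Id - A\<close> is injective, which
  makes \<open>B\<close> also a left inverse and lets it inherit linearity over the scalar field.
\<close>

lemma (in hilbert_space) is_inverse_in_id_minus:
  assumes A: "A \<in> cont_lin_ops smul" and less: "norm A < 1"
  shows "\<exists>B. is_inverse_in smul (id_blinfun - A) B"
proof -
  have "\<exists>!B. id_blinfun + (A o\<^sub>L B) = B"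
  proof (rule banach_fix_type)
    show "\<forall>B C. dist (id_blinfun + (A o\<^sub>L B)) (id_blinfun + (A o\<^sub>L C)) \<le> norm A * dist B C"
      using norm_blinfun_compose
      by (auto simp: dist_norm bounded_bilinear.diff_right[OF bounded_bilinear_blinfun_compose, symmetric])
  qed (use less in auto)
  then obtain B where B: "id_blinfun + (A o\<^sub>L B) = B" by blast
  have fixed: "x + A (B x) = B x" for x
    using arg_cong[OF B, of "\<lambda>F. blinfun_apply F x"] by (simp add: blinfun.add_left)
  have inj: "x = y" if "x - A x = y - A y" for x y
  proof -
    have "A (x - y) = x - y" using that by (simp add: blinfun.diff_right algebra_simps)
    with blinfun_fixed_point_zero[OF less] show ?thesis by fastforce
  qed
  have right: "B x - A (B x) = x" for x
    using fixed[of x] by (simp add: algebra_simps)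
  have A_smul: "A (smul a x) = smul a (A x)" for a x
    using A by (simp add: cont_lin_ops_def)
  have "B (smul a x) = smul a (B x)" for a x
    by (rule inj) (simp add: right A_smul scale_right_diff_distrib[symmetric])
  moreover have "B (x - A x) = x" for x
    by (rule inj) (rule right)
  ultimately have "is_inverse_in smul (id_blinfun - A) B"
    by (auto simp: is_inverse_in_def cont_lin_ops_def blinfun.diff_left right intro!: blinfun_eqI)
  then show ?thesis ..
qed

lemma (in hilbert_space) id_minus_in_cont_lin_ops:
  "A \<in> cont_lin_ops smul \<Longrightarrow> id_blinfun - A \<in> cont_lin_ops smul"
  by (simp add: cont_lin_ops_def blinfun.diff_left scale_right_diff_distrib)

section \<open>Dirac measures and their series\<close>

lemma bounded_linear_meas: "bounded_linear (\<lambda>\<mu>. meas \<mu> B)"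
  by (rule bounded_linear_intro[of _ 1])
    (simp_all add: plus_cabv.rep_eq scaleR_cabv.rep_eq norm_meas_le)

text \<open>Exactly one block of a partition contains \<open>t\<close>, so every variation sum equals \<open>\<parallel>x\<parallel>\<close>.\<close>

lemma norm_dirac_measure_le: "norm (dirac_measure t x) \<le> norm x"
  unfolding norm_cabv.rep_eq
proof (rule total_variation_least)
  fix P :: "'a set set" assume P: "P \<in> borel_partitions"
  then have fin: "finite P" and borel: "\<And>A. A \<in> P \<Longrightarrow> A \<in> sets borel" and cov: "\<Union>P = UNIV"
    and disj: "disjoint_family_on (\<lambda>A. A) P"
    by (auto simp: borel_partitions_def partition_on_def disjoint_def disjoint_family_on_def)
  have "(\<Sum>A\<in>P. norm (meas (dirac_measure t x) A)) = (\<Sum>A\<in>P. indicat_real A t) * norm x"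
    unfolding sum_distrib_right
    by (intro sum.cong) (simp_all add: dirac_measure.rep_eq borel)
  also have "(\<Sum>A\<in>P. indicat_real A t) = indicat_real (\<Union>P) t"
    using indicator_UN_disjoint[OF fin disj] by (metis image_ident)
  also have "\<dots> = 1" by (simp add: cov)
  finally show "(\<Sum>A\<in>P. norm (meas (dirac_measure t x) A)) \<le> norm x" by simp
qed

lemma bounded_linear_dirac_measure:
  "bounded_linear (dirac_measure t :: 'c::real_normed_vector \<Rightarrow> _)"
proof (rule bounded_linear_intro[of _ 1])
  show "dirac_measure t (x + y) = dirac_measure t x + dirac_measure t y" for x y :: 'c
    by (rule cabv_eqI) (simp add: dirac_measure.rep_eq plus_cabv.rep_eq scaleR_add_right)
  show "dirac_measure t (r *\<^sub>R x) = r *\<^sub>R dirac_measure t x" for r and x :: 'c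
    by (rule cabv_eqI) (simp add: dirac_measure.rep_eq scaleR_cabv.rep_eq)
  show "norm (dirac_measure t x) \<le> norm x * 1" for x :: 'c
    by (simp add: norm_dirac_measure_le)
qed

text \<open>The preimage of \<open>B\<close> under the constant map is \<open>UNIV\<close> or empty, according to \<open>t \<in> B\<close>.\<close>

lemma op_measure_image_const:
  "op_measure A (image_measure (\<lambda>_. t) \<mu>) = dirac_measure t (A (meas \<mu> UNIV))"
  by (rule cabv_eqI)
    (simp add: op_measure.rep_eq image_measure.rep_eq dirac_measure.rep_eq indicator_def
      vector_measure_empty[OF meas_vector_measure] blinfun.zero_right)

definition dirac_series ::
    "(nat \<Rightarrow> 't::topological_space) \<Rightarrow> (nat \<Rightarrow> 'x::real_normed_vector \<Rightarrow>\<^sub>L 'y::banach) \<Rightarrow> 'x \<Rightarrow> ('t, 'y) cabv"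
  where "dirac_series t A v = (\<Sum>i. dirac_measure (t i) (A i v))"

lemma norm_dirac_term_le: "norm (dirac_measure t (blinfun_apply A v)) \<le> norm A * norm v"
  by (rule order_trans[OF norm_dirac_measure_le norm_blinfun])

lemma summable_dirac_series:
  fixes A :: "nat \<Rightarrow> 'x::real_normed_vector \<Rightarrow>\<^sub>L 'y::banach"
  assumes "summable (\<lambda>i. norm (A i))"
  shows "summable (\<lambda>i. dirac_measure (t i) (A i v))"
  by (rule summable_comparison_test'[OF summable_mult2[OF assms, of "norm v"], of 0])
    (rule norm_dirac_term_le)

lemma norm_dirac_series_le:
  fixes A :: "nat \<Rightarrow> 'x::real_normed_vector \<Rightarrow>\<^sub>L 'y::banach"
  assumes "summable (\<lambda>i. norm (A i))"
  shows "norm (dirac_series t A v) \<le> (\<Sum>i. norm (A i)) * norm v"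
  unfolding dirac_series_def suminf_mult2[OF assms]
  by (rule norm_suminf_le[OF norm_dirac_term_le summable_mult2[OF assms]])

lemma dirac_series_diff:
  fixes A :: "nat \<Rightarrow> 'x::real_normed_vector \<Rightarrow>\<^sub>L 'y::banach"
  assumes "summable (\<lambda>i. norm (A i))"
  shows "dirac_series t A v - dirac_series t A w = dirac_series t A (v - w)"
  unfolding dirac_series_def
  by (subst suminf_diff)
    (simp_all add: assms summable_dirac_series blinfun.diff_right
      bounded_linear.linear[OF bounded_linear_dirac_measure, THEN linear_diff])

text \<open>
  Evaluation at the whole space is continuous for the variational norm, so it may be applied to the
  series term by term; each Dirac measure has mass one.
\<close>

lemma total_mass_dirac_series:
  fixes A :: "nat \<Rightarrow> 'x::real_normed_vector \<Rightarrow>\<^sub>L 'y::banach"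
  assumes norms: "summable (\<lambda>i. norm (A i))" and S: "A sums S"
  shows "meas (dirac_series t A v) UNIV = S v"
proof -
  have "(\<lambda>i. meas (dirac_measure (t i) (A i v)) UNIV) sums meas (dirac_series t A v) UNIV"
    unfolding dirac_series_def
    by (intro bounded_linear.sums[OF bounded_linear_meas] summable_sums summable_dirac_series norms)
  then have "(\<lambda>i. A i v) sums meas (dirac_series t A v) UNIV"
    by (simp add: dirac_measure.rep_eq)
  with bounded_linear.sums[OF bounded_linear_apply_blinfun S] show ?thesis
    using sums_unique2 by blast
qed

section \<open>The affine contraction and its fixed point\<close>

lemma lipschitz_const_le: "L-lipschitz_on UNIV f \<Longrightarrow> lipschitz_const f \<le> L"
  unfolding lipschitz_const_def
  by (intro cInf_lower bdd_belowI[of _ 0]) (auto dest: lipschitz_on_nonneg)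

lemma lipschitz_dirac_series_plus:
  fixes A :: "nat \<Rightarrow> 'x::banach \<Rightarrow>\<^sub>L 'x" and \<mu>0 :: "('t::topological_space, 'x) cabv"
  assumes norms: "summable (\<lambda>i. norm (A i))"
  shows "(\<Sum>i. norm (A i))-lipschitz_on UNIV (\<lambda>\<mu> :: ('t, 'x) cabv. dirac_series t A (meas \<mu> UNIV) + \<mu>0)"
proof (rule lipschitz_onI)
  show nonneg: "0 \<le> (\<Sum>i. norm (A i))" by (rule suminf_nonneg[OF norms]) simp
  fix \<mu> \<nu> :: "('t, 'x) cabv"
  have "dist (dirac_series t A (meas \<mu> UNIV) + \<mu>0) (dirac_series t A (meas \<nu> UNIV) + \<mu>0)
      = norm (dirac_series t A (meas (\<mu> - \<nu>) UNIV))"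
    by (simp add: dist_norm dirac_series_diff[OF norms] minus_cabv.rep_eq)
  also have "\<dots> \<le> (\<Sum>i. norm (A i)) * norm (meas (\<mu> - \<nu>) UNIV)"
    by (rule norm_dirac_series_le[OF norms])
  also have "\<dots> \<le> (\<Sum>i. norm (A i)) * dist \<mu> \<nu>"
    unfolding dist_norm by (intro mult_left_mono norm_meas_le nonneg)
  finally show "dist (dirac_series t A (meas \<mu> UNIV) + \<mu>0) (dirac_series t A (meas \<nu> UNIV) + \<mu>0)
      \<le> (\<Sum>i. norm (A i)) * dist \<mu> \<nu>" .
qed

text \<open>
  Write \<open>D\<close> for \<open>dirac_series t A\<close>. Taking total masses in
  \<open>\<nu> = D (\<nu>(T)) + \<mu>\<^sup>0\<close> gives \<open>(Id - S) \<nu>(T) = \<mu>\<^sup>0(T)\<close>, which fixes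
  \<open>\<nu>(T)\<close> and thereby \<open>\<nu>\<close>; conversely the measure with this mass is a fixed point.
\<close>

lemma dirac_series_plus_fixed_point_iff:
  fixes A :: "nat \<Rightarrow> 'x::banach \<Rightarrow>\<^sub>L 'x" and \<mu>0 :: "('t::topological_space, 'x) cabv"
  assumes norms: "summable (\<lambda>i. norm (A i))" and S: "A sums S"
    and B: "is_inverse_in smul (id_blinfun - S) B"
  shows "dirac_series t A (meas \<nu> UNIV) + \<mu>0 = \<nu> \<longleftrightarrow> \<nu> = dirac_series t A (B (meas \<mu>0 UNIV)) + \<mu>0"
proof
  have mass: "meas (dirac_series t A v + \<mu>0) UNIV = S v + meas \<mu>0 UNIV" for v
    by (simp add: plus_cabv.rep_eq total_mass_dirac_series[OF norms S])
  have left: "B (x - S x) = x" for x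
  proof -
    have "B (x - S x) = (B o\<^sub>L (id_blinfun - S)) x" by (simp add: blinfun.diff_left)
    also have "\<dots> = x" using B by (simp add: is_inverse_in_def)
    finally show ?thesis .
  qed
  have right: "B x - S (B x) = x" for x
  proof -
    have "B x - S (B x) = ((id_blinfun - S) o\<^sub>L B) x" by (simp add: blinfun.diff_left)
    also have "\<dots> = x" using B by (simp add: is_inverse_in_def)
    finally show ?thesis .
  qed
  {
    assume fixed: "dirac_series t A (meas \<nu> UNIV) + \<mu>0 = \<nu>"
    have "meas \<nu> UNIV - S (meas \<nu> UNIV) = meas \<mu>0 UNIV"
      using mass[of "meas \<nu> UNIV"] unfolding fixed by (simp add: algebra_simps)
    with left[of "meas \<nu> UNIV"] have "meas \<nu> UNIV = B (meas \<mu>0 UNIV)" by simp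
    with fixed show "\<nu> = dirac_series t A (B (meas \<mu>0 UNIV)) + \<mu>0" by simp
  }
  {
    assume \<nu>: "\<nu> = dirac_series t A (B (meas \<mu>0 UNIV)) + \<mu>0"
    have "meas \<nu> UNIV = B (meas \<mu>0 UNIV)"
      unfolding \<nu> mass using right[of "meas \<mu>0 UNIV"] by (simp add: algebra_simps)
    with \<nu> show "dirac_series t A (meas \<nu> UNIV) + \<mu>0 = \<nu>" by simp
  }
qed

theorem theorem3p2p4:
  fixes smul :: "'k::real_or_complex \<Rightarrow> 'x::banach \<Rightarrow> 'x"
    and ip :: "'x \<Rightarrow> 'x \<Rightarrow> 'k"
    and t :: "nat \<Rightarrow> 't::metric_space"
    and \<omega> :: "nat \<Rightarrow> 't \<Rightarrow> 't"
    and Rs :: "nat \<Rightarrow> 'x \<Rightarrow>\<^sub>L 'x"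
    and R :: "'x \<Rightarrow>\<^sub>L 'x"
    and \<mu>0 :: "('t, 'x) cabv"
    and e :: real
    and H H2 :: "('t, 'x) cabv \<Rightarrow> ('t, 'x) cabv"
  assumes hilbert: "hilbert_space smul ip"
    and nontrivial: "\<exists>x::'x. x \<noteq> 0"
    and compact: "compact (UNIV :: 't set)"
    and distinct: "inj t"
    and \<omega>_def: "\<And>i s. \<omega> i s = t i"
    and operators: "\<And>i. Rs i \<in> cont_lin_ops smul"
    and summable: "summable (\<lambda>i. norm (Rs i))"
    and e_def: "e = (\<Sum>i. norm (Rs i))"
    and e_less: "e < 1"
    and R_def: "R = (\<Sum>i. Rs i)"
    and H_def: "\<And>\<mu>. H \<mu> = (\<Sum>i. op_measure (Rs i) (image_measure (\<omega> i) \<mu>))"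
    and H2_def: "\<And>\<mu>. H2 \<mu> = H \<mu> + \<mu>0"
  shows "(Rs sums R \<and> R \<in> cont_lin_ops smul) \<and>
    (\<forall>\<mu>. summable (\<lambda>i. op_measure (Rs i) (image_measure (\<omega> i) \<mu>)) \<and>
      summable (\<lambda>i. dirac_measure (t i) (Rs i (meas \<mu> UNIV))) \<and>
      H2 \<mu> = (\<Sum>i. dirac_measure (t i) (Rs i (meas \<mu> UNIV))) + \<mu>0) \<and>
    invertible_in smul (id_blinfun - R) \<and>
    contraction H2 \<and> lipschitz_const H2 \<le> e \<and>
    (\<exists>\<mu>s. H2 \<mu>s = \<mu>s \<and> (\<forall>\<nu>. H2 \<nu> = \<nu> \<longrightarrow> \<nu> = \<mu>s) \<and>
      summable (\<lambda>i. dirac_measure (t i)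
        ((Rs i o\<^sub>L inverse_in smul (id_blinfun - R)) (meas \<mu>0 UNIV))) \<and>
      \<mu>s = (\<Sum>i. dirac_measure (t i)
        ((Rs i o\<^sub>L inverse_in smul (id_blinfun - R)) (meas \<mu>0 UNIV))) + \<mu>0)"
proof -
  interpret hilbert_space smul ip by (fact hilbert)
  have Rs_sums: "Rs sums R"
    unfolding R_def by (rule summable_sums[OF summable_norm_cancel[OF summable]])
  have R_op: "R \<in> cont_lin_ops smul"
    by (rule cont_lin_ops_sums[OF Rs_sums operators])
  have "norm R \<le> e"
    unfolding R_def e_def by (rule summable_norm[OF summable])
  with e_less have "norm R < 1" by simp
  then obtain B where B: "is_inverse_in smul (id_blinfun - R) B"
    using is_inverse_in_id_minus[OF R_op] by blast
  have inv: "inverse_in smul (id_blinfun - R) = B"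
    by (rule inverse_in_eqI[OF B])
  have invertible: "invertible_in smul (id_blinfun - R)"
    using B id_minus_in_cont_lin_ops[OF R_op] by (auto simp: invertible_in_def)
  have "\<omega> i = (\<lambda>_. t i)" for i
    by (rule ext) (rule \<omega>_def)
  then have term_eq: "op_measure (Rs i) (image_measure (\<omega> i) \<mu>)
      = dirac_measure (t i) (Rs i (meas \<mu> UNIV))" for i \<mu>
    by (simp add: op_measure_image_const)
  have H2_eq: "H2 = (\<lambda>\<mu>. dirac_series t Rs (meas \<mu> UNIV) + \<mu>0)"
    by (rule ext) (simp add: H2_def H_def term_eq dirac_series_def)
  have lip: "e-lipschitz_on UNIV H2"
    unfolding H2_eq e_def by (rule lipschitz_dirac_series_plus[OF summable])
  have const: "lipschitz_const H2 \<le> e"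
    by (rule lipschitz_const_le[OF lip])
  with lip e_less have contr: "contraction H2"
    by (auto simp: contraction_def)
  have fixed: "H2 \<nu> = \<nu> \<longleftrightarrow> \<nu> = dirac_series t Rs (B (meas \<mu>0 UNIV)) + \<mu>0" for \<nu>
    unfolding H2_eq by (rule dirac_series_plus_fixed_point_iff[OF summable Rs_sums B])
  show ?thesis
    unfolding inv term_eq blinfun_apply_blinfun_compose dirac_series_def[symmetric]
    using Rs_sums R_op invertible const contr fixed summable_dirac_series[OF summable]
    by (auto simp: H2_eq)
qed

end
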